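(* Suppose that Assumption A, stated in the context, holds, let $\pi\in\Pi^{DS}$, and let $v\in\mathbb{B}_\xi(\mathcal{X})$. Then the operator $T^\pi:\mathbb{B}_\xi(\mathcal{X})\to\mathbb{B}_\xi(\mathcal{X})$, $$(T^\pi v)(\boldsymbol{x}):=\sup_{\boldsymbol{\mu}\in\mathcal{D}}\Big[c(\boldsymbol{x},\pi(\boldsymbol{x}))+\alpha\int_{\mathcal{W}}v(f(\boldsymbol{x},\pi(\boldsymbol{x}),w))\,\boldsymbol{\mu}(\mathrm{d}w)\Big],$$ satisfies, for all $\boldsymbol{x}\in\mathcal{X}$, $$(T^\pi v)(\boldsymbol{x})=\sup_{(w,q)\in B}\Big[c(\boldsymbol{x},\pi(\boldsymbol{x}))+\frac{\alpha}{N}\sum_{i=1}^N\big[q_1v(f(\boldsymbol{x},\pi(\boldsymbol{x}),\underline w^{(i)}))+q_2v(f(\boldsymbol{x},\pi(\boldsymbol{x}),\overline w^{(i)}))\big]\Big],$$ where $$B:=\Big\{(w,q)\ \Big|\ w=(\underline w^{(1)},\ldots,\underline w^{(N)},\overline w^{(1)},\ldots,\overline w^{(N)})\in\mathcal{W}^{2N},\ q\in\Delta,\ \frac1N\sum_{i=1}^N\big[q_1d(\underline w^{(i)},\hat w^{(i)})^p+q_2d(\overline w^{(i)},\hat w^{(i)})^p\big]\le\theta^p\Big\}$$ and $\Delta:=\{(q_1,q_2)\in\mathbb{R}^2\mid q_1,q_2\ge0,\ q_1+q_2=1\}$.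
   Context: Setting. $\mathcal{X}\subseteq\mathbb{R}^n$, $\mathcal{U}\subseteq\mathbb{R}^m$, $\mathcal{W}\subseteq\mathbb{R}^l$ are Borel sets; $f$ gives the system dynamics $x_{t+1}=f(x_t,u_t,w_t)$ with values in $\mathcal{X}$; $\mathcal{U}(\boldsymbol{x})\subseteq\mathcal{U}$ is the set of admissible actions at $\boldsymbol{x}$; $\mathbb{K}:=\{(\boldsymbol{x},\boldsymbol{u})\in\mathcal{X}\times\mathcal{U}\mid\boldsymbol{u}\in\mathcal{U}(\boldsymbol{x})\}$; $c:\mathcal{X}\times\mathcal{U}\to\mathbb{R}$ is the stage cost; $\alpha\in(0,1)$. Given samples $\hat w^{(1)},\ldots,\hat w^{(N)}\in\mathcal{W}$, $\nu_N:=\frac1N\sum_i\delta_{\hat w^{(i)}}$; $W_p$ ($p\in[1,\infty)$) is the Wasserstein distance of order $p$ for a metric $d$ on $\mathcal{W}$; $\mathcal{D}:=\{\mu\in\mathcal{P}(\mathcal{W})\mid W_p(\mu,\nu_N)\le\theta\}$ with $\theta>0$. $\Pi^{DS}$ is the set of measurable $\pi:\mathcal{X}\to\mathcal{U}$ with $\pi(\boldsymbol{x})\in\mathcal{U}(\boldsymbol{x})$ for all $\boldsymbol{x}$. Assumption A. (1) $c$ is lower semicontinuous on $\mathbb{K}$ and $|c(\boldsymbol{x},\boldsymbol{u})|\le b\,\xi(\boldsymbol{x})$ on $\mathbb{K}$ for some constant $b\ge0$ and continuous $\xi:\mathcal{X}\to[1,\infty)$ such that $\xi'(\boldsymbol{x},\boldsymbol{u}):=\int_{\mathcal{W}}\xi(f(\boldsymbol{x},\boldsymbol{u},w))\boldsymbol{\mu}(\mathrm{d}w)$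 is continuous on $\mathbb{K}$ for every $\boldsymbol{\mu}\in\mathcal{D}$; and there is a constant $\beta\in[1,1/\alpha)$ with $\xi'(\boldsymbol{x},\boldsymbol{u})\le\beta\xi(\boldsymbol{x})$ for all $(\boldsymbol{x},\boldsymbol{u})\in\mathbb{K}$ (and every $\boldsymbol{\mu}\in\mathcal{D}$). (2) For each continuous bounded $\chi:\mathcal{X}\to\mathbb{R}$, $(\boldsymbol{x},\boldsymbol{u})\mapsto\int_{\mathcal{W}}\chi(f(\boldsymbol{x},\boldsymbol{u},w))\boldsymbol{\mu}(\mathrm{d}w)$ is continuous on $\mathbb{K}$ for every $\boldsymbol{\mu}\in\mathcal{D}$. (3) $\mathcal{U}(\boldsymbol{x})$ is compact for every $\boldsymbol{x}$ and $\boldsymbol{x}\mapsto\mathcal{U}(\boldsymbol{x})$ is upper semicontinuous. $\mathbb{B}_\xi(\mathcal{X})$ is the Banach space of measurable $v:\mathcal{X}\to\mathbb{R}$ with $\|v\|_\xi:=\sup_{\boldsymbol{x}}|v(\boldsymbol{x})|/\xi(\boldsymbol{x})<\infty$.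
   Formalization: That T^π maps B_ξ(X) into itself is proved only as finiteness of the weighted norm of T^π v; Borel measurability of T^π v is dropped because it can fail (the supremum may project a Borel set to a non-Borel one). *)

theory Defs
  imports "HOL-Probability.Probability"
begin

abbreviation borel_on :: "'a::topological_space set \<Rightarrow> 'a measure"
  where "borel_on S \<equiv> restrict_space borel S"

definition prob_measures :: "'a::topological_space set \<Rightarrow> 'a measure set"
  where "prob_measures W = {\<mu>. sets \<mu> = sets (borel_on W) \<and> prob_space \<mu>}"

definition couplings :: "'a::topological_space set \<Rightarrow> 'a measure \<Rightarrow> 'a measure \<Rightarrow> ('a \<times> 'a) measure set"
  where "couplings W \<mu> \<nu> =
    {\<gamma>. sets \<gamma> = sets (borel_on W \<Otimes>\<^sub>M borel_on W) \<and> prob_space \<gamma> \<and>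
        distr \<gamma> (borel_on W) fst = \<mu> \<and> distr \<gamma> (borel_on W) snd = \<nu>}"

text \<open>The optimal transport cost may be infinite, and there is no real power on \<^typ>\<open>ennreal\<close>;
  hence the case distinction.\<close>

definition wasserstein ::
    "'a::topological_space set \<Rightarrow> ('a \<Rightarrow> 'a \<Rightarrow> real) \<Rightarrow> real \<Rightarrow> 'a measure \<Rightarrow> 'a measure \<Rightarrow> ennreal"
  where "wasserstein W d p \<mu> \<nu> =
    (let C = (INF \<gamma>\<in>couplings W \<mu> \<nu>. \<integral>\<^sup>+ z. ennreal (d (fst z) (snd z) powr p) \<partial>\<gamma>)
     in if C = \<infinity> then \<infinity> else ennreal (enn2real C powr (1 / p)))"

text \<open>The push-forward under \<open>what\<close> of the uniform distribution on the indices \<open>1..N\<close>, so that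
  repeated samples are counted with multiplicity; see \<open>emeasure_empirical\<close> below.\<close>

definition empirical :: "'a::topological_space set \<Rightarrow> nat \<Rightarrow> (nat \<Rightarrow> 'a) \<Rightarrow> 'a measure"
  where "empirical W N what = distr (uniform_count_measure {1..N}) (borel_on W) what"

lemma emeasure_empirical:
  assumes "N \<ge> 1" and "\<And>i. i \<in> {1..N} \<Longrightarrow> what i \<in> W" and "S \<in> sets (borel_on W)"
  shows "emeasure (empirical W N what) S
    = ennreal (1 / real N * (\<Sum>i=1..N. measure (return (borel_on W) (what i)) S))"
proof -
  have m: "what \<in> measurable (uniform_count_measure {1..N}) (borel_on W)"
    using assms(2)
    by (auto simp: measurable_def space_uniform_count_measure sets_uniform_count_measure
        space_restrict_space)
  have "emeasure (empirical W N what) S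
      = emeasure (uniform_count_measure {1..N}) (what -` S \<inter> {1..N})"
    unfolding empirical_def using assms(3) m
    by (simp add: emeasure_distr space_uniform_count_measure)
  also have "\<dots> = ennreal (real (card (what -` S \<inter> {1..N})) / real N)"
    using assms(1) by (subst emeasure_uniform_count_measure) auto
  also have "real (card (what -` S \<inter> {1..N})) = (\<Sum>i=1..N. indicator S (what i))"
    by (simp add: indicator_def sum.If_cases Int_def vimage_def conj_commute)
  also have "\<dots> = (\<Sum>i=1..N. measure (return (borel_on W) (what i)) S)"
    using assms(3) by (intro sum.cong refl) (simp add: measure_return)
  finally show ?thesis by simp
qed

definition wasserstein_ball ::
    "'a::topological_space set \<Rightarrow> ('a \<Rightarrow> 'a \<Rightarrow> real) \<Rightarrow> real \<Rightarrow> real \<Rightarrow> nat \<Rightarrow> (nat \<Rightarrow> 'a) \<Rightarrow> 'a measure set"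
  where "wasserstein_ball W d p \<theta> N what =
    {\<mu> \<in> prob_measures W. wasserstein W d p \<mu> (empirical W N what) \<le> ennreal \<theta>}"

definition graph_adm :: "'x set \<Rightarrow> 'u set \<Rightarrow> ('x \<Rightarrow> 'u set) \<Rightarrow> ('x \<times> 'u) set"
  where "graph_adm X U adm = {(x, u). x \<in> X \<and> u \<in> U \<and> u \<in> adm x}"

definition lsc_on :: "'a::topological_space set \<Rightarrow> ('a \<Rightarrow> real) \<Rightarrow> bool"
  where "lsc_on S g \<longleftrightarrow> (\<forall>x\<in>S. \<forall>a. a < g x \<longrightarrow> (\<forall>\<^sub>F y in at x within S. a < g y))"

definition usc_multifunction_on ::
    "'a::topological_space set \<Rightarrow> ('a \<Rightarrow> 'b::topological_space set) \<Rightarrow> bool"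
  where "usc_multifunction_on S F \<longleftrightarrow>
    (\<forall>x\<in>S. \<forall>V. open V \<and> F x \<subseteq> V \<longrightarrow> (\<forall>\<^sub>F y in at x within S. F y \<subseteq> V))"

text \<open>The integrability conjunct expresses that the Bochner integral defining \<open>\<xi>'\<close> is a genuine
  one (it would be 0 for a non-integrable integrand).\<close>

definition assumption_A ::
    "'x::topological_space set \<Rightarrow> 'u::topological_space set \<Rightarrow> ('x \<Rightarrow> 'u set) \<Rightarrow>
     ('x \<Rightarrow> 'u \<Rightarrow> 'w \<Rightarrow> 'x) \<Rightarrow> ('x \<Rightarrow> 'u \<Rightarrow> real) \<Rightarrow> real \<Rightarrow> 'w measure set \<Rightarrow> ('x \<Rightarrow> real) \<Rightarrow> bool"
  where "assumption_A X U adm f c \<alpha> D \<xi> \<longleftrightarrow>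
    (let K = graph_adm X U adm in
      lsc_on K (\<lambda>(x, u). c x u) \<and>
      continuous_on X \<xi> \<and> (\<forall>x\<in>X. 1 \<le> \<xi> x) \<and>
      (\<exists>b\<ge>0. \<forall>(x, u)\<in>K. \<bar>c x u\<bar> \<le> b * \<xi> x) \<and>
      (\<forall>\<mu>\<in>D. (\<forall>(x, u)\<in>K. integrable \<mu> (\<lambda>w. \<xi> (f x u w))) \<and>
               continuous_on K (\<lambda>(x, u). \<integral>w. \<xi> (f x u w) \<partial>\<mu>)) \<and>
      (\<exists>\<beta>. 1 \<le> \<beta> \<and> \<beta> < 1 / \<alpha> \<and>
         (\<forall>\<mu>\<in>D. \<forall>(x, u)\<in>K. (\<integral>w. \<xi> (f x u w) \<partial>\<mu>) \<le> \<beta> * \<xi> x)) \<and>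
      (\<forall>g :: 'x \<Rightarrow> real. continuous_on X g \<and> bounded (g ` X) \<longrightarrow>
         (\<forall>\<mu>\<in>D. continuous_on K (\<lambda>(x, u). \<integral>w. g (f x u w) \<partial>\<mu>))) \<and>
      (\<forall>x\<in>X. compact (adm x)) \<and>
      usc_multifunction_on X adm)"

definition stationary_policies ::
    "'x::topological_space set \<Rightarrow> 'u::topological_space set \<Rightarrow> ('x \<Rightarrow> 'u set) \<Rightarrow> ('x \<Rightarrow> 'u) set"
  where "stationary_policies X U adm =
    {\<pi>. \<pi> \<in> borel_on X \<rightarrow>\<^sub>M borel_on U \<and> (\<forall>x\<in>X. \<pi> x \<in> adm x)}"

definition finite_weighted_norm :: "'x set \<Rightarrow> ('x \<Rightarrow> real) \<Rightarrow> ('x \<Rightarrow> real) \<Rightarrow> bool"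
  where "finite_weighted_norm X \<xi> v \<longleftrightarrow> bdd_above ((\<lambda>x. \<bar>v x\<bar> / \<xi> x) ` X)"

definition weighted_bounded :: "'x::topological_space set \<Rightarrow> ('x \<Rightarrow> real) \<Rightarrow> ('x \<Rightarrow> real) set"
  where "weighted_bounded X \<xi> = {v \<in> borel_measurable (borel_on X). finite_weighted_norm X \<xi> v}"

definition dr_value ::
    "('x \<Rightarrow> 'u \<Rightarrow> 'w \<Rightarrow> 'x) \<Rightarrow> ('x \<Rightarrow> 'u \<Rightarrow> real) \<Rightarrow> real \<Rightarrow> ('x \<Rightarrow> 'u) \<Rightarrow> ('x \<Rightarrow> real) \<Rightarrow> 'x \<Rightarrow>
     'w measure \<Rightarrow> real"
  where "dr_value f c \<alpha> \<pi> v x \<mu> = c x (\<pi> x) + \<alpha> * (\<integral>w. v (f x (\<pi> x) w) \<partial>\<mu>)"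

text \<open>The supremum is that of \<^typ>\<open>real\<close>, hence meaningful only for a family that is bounded
  above. For Borel measurable \<open>v\<close> the function \<open>dr_operator f c \<alpha> D \<pi> v\<close> need not be Borel
  measurable: the supremum can amount to projecting a Borel set along the disturbance space.\<close>

definition dr_operator ::
    "('x \<Rightarrow> 'u \<Rightarrow> 'w \<Rightarrow> 'x) \<Rightarrow> ('x \<Rightarrow> 'u \<Rightarrow> real) \<Rightarrow> real \<Rightarrow> 'w measure set \<Rightarrow> ('x \<Rightarrow> 'u) \<Rightarrow>
     ('x \<Rightarrow> real) \<Rightarrow> 'x \<Rightarrow> real"
  where "dr_operator f c \<alpha> D \<pi> v x = (SUP \<mu>\<in>D. dr_value f c \<alpha> \<pi> v x \<mu>)"

definition simplex2 :: "(real \<times> real) set"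
  where "simplex2 = {(q1, q2). 0 \<le> q1 \<and> 0 \<le> q2 \<and> q1 + q2 = 1}"

text \<open>A point of \<open>W\<^sup>2\<^sup>N\<close> is given by its lower and its upper half, two families indexed
  by \<open>1..N\<close>.\<close>

definition two_point_set ::
    "'w set \<Rightarrow> ('w \<Rightarrow> 'w \<Rightarrow> real) \<Rightarrow> real \<Rightarrow> real \<Rightarrow> nat \<Rightarrow> (nat \<Rightarrow> 'w) \<Rightarrow>
     (((nat \<Rightarrow> 'w) \<times> (nat \<Rightarrow> 'w)) \<times> (real \<times> real)) set"
  where "two_point_set W d p \<theta> N what =
    {((wl, wu), (q1, q2)).
       wl \<in> {1..N} \<rightarrow>\<^sub>E W \<and> wu \<in> {1..N} \<rightarrow>\<^sub>E W \<and> (q1, q2) \<in> simplex2 \<and>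
       1 / real N * (\<Sum>i=1..N. q1 * d (wl i) (what i) powr p + q2 * d (wu i) (what i) powr p)
         \<le> \<theta> powr p}"

definition two_point_value ::
    "('x \<Rightarrow> 'u \<Rightarrow> 'w \<Rightarrow> 'x) \<Rightarrow> ('x \<Rightarrow> 'u \<Rightarrow> real) \<Rightarrow> real \<Rightarrow> nat \<Rightarrow> ('x \<Rightarrow> 'u) \<Rightarrow> ('x \<Rightarrow> real) \<Rightarrow> 'x \<Rightarrow>
     ((nat \<Rightarrow> 'w) \<times> (nat \<Rightarrow> 'w)) \<times> (real \<times> real) \<Rightarrow> real"
  where "two_point_value f c \<alpha> N \<pi> v x = (\<lambda>((wl, wu), (q1, q2)).
    c x (\<pi> x) + \<alpha> / real N *
      (\<Sum>i=1..N. q1 * v (f x (\<pi> x) (wl i)) + q2 * v (f x (\<pi> x) (wu i))))"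

end

theory Submission
  imports Defs
begin

text \<open>A point of \<open>W\<^sup>N\<close> has a transport cost \<open>a\<close> and a reward \<open>b\<close>. If no two-point mixture of cost
  at most \<open>T = \<theta>\<^sup>p\<close> has reward above \<open>V\<close>, then every chord slope \<open>(b j - V) / (a j - T)\<close> to the
  right of \<open>T\<close> is at most every slope \<open>(V - b i) / (T - a i)\<close> to the left of it, so that some line
  of slope \<open>\<eta> \<ge> 0\<close> through \<open>(T, V)\<close> lies above all points \<open>(a, b)\<close>. The resulting inequality is a
  sum over the samples, hence splits into the suprema of \<open>g w - \<eta> * d w y powr p\<close>, and
  integrating it against an almost optimal coupling bounds the integral of \<open>g\<close> over the whole
  ball by \<open>V\<close>. Conversely, a two-point mixture is itself the integral over a measure in the ball.\<close>

section \<open>Separating line and suprema over a product\<close>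

lemma slope_separation:
  fixes a b :: "'i \<Rightarrow> real"
  assumes i0: "i0 \<in> I" "a i0 < T"
    and two: "\<And>i j q. i \<in> I \<Longrightarrow> j \<in> I \<Longrightarrow> 0 \<le> q \<Longrightarrow> q \<le> 1 \<Longrightarrow>
      q * a i + (1 - q) * a j \<le> T \<Longrightarrow> q * b i + (1 - q) * b j \<le> V"
  shows "\<exists>\<eta>\<ge>0. \<forall>i\<in>I. b i \<le> V + \<eta> * (a i - T)"
proof -
  have below: "b i \<le> V" if "i \<in> I" "a i \<le> T" for i
    using two[of i i 1] that by simp
  \<comment> \<open>Each chord slope to the right of \<open>T\<close> is a lower bound on an
    admissible \<eta>. Inserting 0 forces \<eta> to be nonnegative and keeps the supremum meaningful
    when no point lies to the right of \<open>T\<close>.\<close>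
  define S where "S = insert 0 ((\<lambda>j. (b j - V) / (a j - T)) ` {j\<in>I. T < a j})"
  have S_le: "s \<le> (V - b i) / (T - a i)" if "s \<in> S" and i: "i \<in> I" "a i < T" for s i
  proof -
    from \<open>s \<in> S\<close> consider "s = 0"
      | j where "j \<in> I" "T < a j" "s = (b j - V) / (a j - T)"
      unfolding S_def by auto
    then show ?thesis
    proof cases
      case 1
      then show ?thesis using below i by simp
    next
      case (2 j)
      \<comment> \<open>The weight at which the mixture of the costs on either side of
        \<open>T\<close> equals \<open>T\<close> exactly, so that \<open>two\<close> applies;
        clearing denominators in its conclusion gives the comparison of slopes.\<close>
      define q where "q = (a j - T) / (a j - a i)"
      have q1: "1 - q = (T - a i) / (a j - a i)"
        using 2 i by (simp add: q_def field_simps)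
      have "q * a i + (1 - q) * a j = T"
        unfolding q1 unfolding q_def using 2 i
        by (simp add: add_divide_distrib[symmetric] nonzero_divide_eq_eq) (simp add: algebra_simps)
      moreover have "0 \<le> q" "q \<le> 1"
        using 2 i by (auto simp: q_def)
      ultimately have "q * b i + (1 - q) * b j \<le> V"
        using two[of i j q] 2 i by simp
      then have "(a j - T) * b i + (T - a i) * b j \<le> V * (a j - a i)"
        unfolding q1 unfolding q_def using 2 i
        by (simp add: add_divide_distrib[symmetric] pos_divide_le_eq)
      then have "(b j - V) * (T - a i) \<le> (V - b i) * (a j - T)"
        by (simp add: algebra_simps)
      then show ?thesis
        unfolding \<open>s = _\<close> using 2(2) i(2) by (simp add: pos_divide_le_eq pos_le_divide_eq)
    qed
  qed
  \<comment> \<open>One point strictly to the left of \<open>T\<close> bounds all chord slopes;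
    without such a point, chords ending just to the right of \<open>T\<close> could be arbitrarily
    steep.\<close>
  have bdd: "bdd_above S"
    using S_le[OF _ i0] by (rule bdd_aboveI)
  show ?thesis
  proof (intro exI[of _ "Sup S"] conjI ballI)
    show "0 \<le> Sup S"
      by (rule cSup_upper[OF _ bdd]) (simp add: S_def)
    fix i assume i: "i \<in> I"
    consider "a i < T" | "a i = T" | "T < a i" by linarith
    then show "b i \<le> V + Sup S * (a i - T)"
    proof cases
      case 1
      have "Sup S \<le> (V - b i) / (T - a i)"
        by (rule cSup_least) (use S_le[OF _ i 1] in \<open>auto simp: S_def\<close>)
      then show ?thesis using 1 by (simp add: pos_le_divide_eq algebra_simps)
    next
      case 2
      then show ?thesis using below i by simp
    next
      case 3
      have "(b i - V) / (a i - T) \<le> Sup S"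
        by (rule cSup_upper[OF _ bdd]) (use 3 i in \<open>auto simp: S_def\<close>)
      then show ?thesis using 3 by (simp add: pos_divide_le_eq algebra_simps)
    qed
  qed
qed

text \<open>The coordinates vary independently over \<open>W\<close>. Freezing all but one at
  \<open>w0\<close> bounds each \<open>\<phi> i\<close>, and choosing a near-maximiser in every
  coordinate at once carries the bound over to the sum of the suprema.\<close>

lemma sum_SUP_le:
  fixes \<phi> :: "'i \<Rightarrow> 'a \<Rightarrow> real"
  assumes I: "finite I" and W: "W \<noteq> {}"
    and le: "\<And>w. w \<in> I \<rightarrow>\<^sub>E W \<Longrightarrow> (\<Sum>i\<in>I. \<phi> i (w i)) \<le> K"
  shows "\<And>i. i \<in> I \<Longrightarrow> bdd_above (\<phi> i ` W)"
    and "(\<Sum>i\<in>I. SUP w\<in>W. \<phi> i w) \<le> K"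
proof -
  obtain w0 where w0: "w0 \<in> W" using W by auto
  show bdd: "bdd_above (\<phi> i ` W)" if i: "i \<in> I" for i
  proof (rule bdd_aboveI2)
    fix w assume "w \<in> W"
    have "(\<Sum>j\<in>I. \<phi> j ((\<lambda>j\<in>I. if j = i then w else w0) j)) \<le> K"
      by (rule le) (use \<open>w \<in> W\<close> w0 in auto)
    also have "(\<Sum>j\<in>I. \<phi> j ((\<lambda>j\<in>I. if j = i then w else w0) j))
        = \<phi> i w + (\<Sum>j\<in>I - {i}. \<phi> j w0)"
      using I i by (subst sum.remove[of _ i]) (auto intro!: sum.cong)
    finally show "\<phi> i w \<le> K - (\<Sum>j\<in>I - {i}. \<phi> j w0)" by simp
  qed
  show "(\<Sum>i\<in>I. SUP w\<in>W. \<phi> i w) \<le> K"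
  proof (rule field_le_epsilon)
    fix e :: real assume e: "0 < e"
    \<comment> \<open>The loss is \<delta> per coordinate, at most \<open>e\<close> in total; the
      added 1 keeps the denominator positive for empty \<open>I\<close>.\<close>
    define \<delta> where "\<delta> = e / (real (card I) + 1)"
    have \<delta>: "0 < \<delta>" using e by (simp add: \<delta>_def)
    have "\<exists>w\<in>W. (SUP w\<in>W. \<phi> i w) - \<delta> < \<phi> i w" if "i \<in> I" for i
      using less_cSUP_iff[OF W bdd[OF that], of "(SUP w\<in>W. \<phi> i w) - \<delta>"] \<delta> by simp
    then obtain w where w: "\<And>i. i \<in> I \<Longrightarrow> w i \<in> W \<and> (SUP w\<in>W. \<phi> i w) - \<delta> < \<phi> i (w i)"
      by metis
    have "(\<Sum>i\<in>I. (SUP w\<in>W. \<phi> i w) - \<delta>) \<le> (\<Sum>i\<in>I. \<phi> i ((\<lambda>i\<in>I. w i) i))"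
      using w by (intro sum_mono) (auto intro: less_imp_le)
    also have "\<dots> \<le> K" using w by (intro le) auto
    finally have "(\<Sum>i\<in>I. SUP w\<in>W. \<phi> i w) \<le> K + real (card I) * \<delta>"
      by (simp add: sum_subtractf)
    also have "real (card I) * \<delta> \<le> e"
      using e by (simp add: \<delta>_def field_simps)
    finally show "(\<Sum>i\<in>I. SUP w\<in>W. \<phi> i w) \<le> K + e" by simp
  qed
qed

section \<open>Integrals and null sets of the empirical measure\<close>

lemma measurable_empirical_sample:
  assumes what: "what \<in> {1..N} \<rightarrow> W"
  shows "what \<in> uniform_count_measure {1..N} \<rightarrow>\<^sub>M borel_on W"
  using assms
  by (auto simp: measurable_def space_uniform_count_measure sets_uniform_count_measure
      space_restrict_space)

lemma integral_empirical:
  fixes h :: "'a::topological_space \<Rightarrow> real"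
  assumes what: "what \<in> {1..N} \<rightarrow> W" and h: "h \<in> borel_measurable (borel_on W)"
  shows "(\<integral>y. h y \<partial>empirical W N what) = (\<Sum>i=1..N. h (what i)) / real N"
  unfolding empirical_def
  using integral_distr[OF measurable_empirical_sample[OF what] h]
  by (simp add: integral_uniform_count_measure)

text \<open>In a T1 space the finite set of samples is closed, hence Borel, so the statement can be
  pulled back along the push-forward to the indices, where it is trivial.\<close>

lemma AE_empirical:
  fixes what :: "nat \<Rightarrow> 'a::t1_space"
  assumes what: "what \<in> {1..N} \<rightarrow> W"
  shows "AE y in empirical W N what. y \<in> what ` {1..N}"
proof -
  have "finite (what ` {1..N})" by simp
  then have "closed (what ` {1..N})" by (rule finite_imp_closed)
  then have "what ` {1..N} \<in> sets borel" by (rule borel_closed)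
  then have "W \<inter> what ` {1..N} \<in> sets (borel_on W)"
    unfolding sets_restrict_space by (rule imageI)
  then have "{y \<in> space (borel_on W). y \<in> what ` {1..N}} \<in> sets (borel_on W)"
    by (simp add: space_restrict_space Int_def)
  from AE_distr_iff[where P = "\<lambda>y. y \<in> what ` {1..N}", OF measurable_empirical_sample[OF what] this]
  have "(AE y in empirical W N what. y \<in> what ` {1..N}) \<longleftrightarrow>
      (AE i in uniform_count_measure {1..N}. what i \<in> what ` {1..N})"
    unfolding empirical_def .
  also have "AE i in uniform_count_measure {1..N}. what i \<in> what ` {1..N}"
    by (rule AE_I2) (simp add: space_uniform_count_measure)
  finally show ?thesis .
qed

section \<open>Upper bounds by integration against a coupling\<close>

text \<open>Weak duality: the pointwise bound is integrated against \<gamma>. The first marginal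
  yields the integral of \<open>g\<close>, the second the average of \<open>s\<close> over the
  samples, and the cost term yields \<open>\<eta> * C\<close>. The bound is only required at
  samples, which carry the whole second marginal.\<close>

lemma coupling_integral_le:
  fixes what :: "nat \<Rightarrow> 'a::t1_space" and k :: "'a \<Rightarrow> 'a \<Rightarrow> real"
  assumes \<gamma>: "\<gamma> \<in> couplings W \<mu> (empirical W N what)"
    and what: "what \<in> {1..N} \<rightarrow> W"
    and g: "integrable \<mu> g"
    and k: "(\<lambda>z. k (fst z) (snd z)) \<in> borel_measurable (borel_on W \<Otimes>\<^sub>M borel_on W)"
    and k0: "\<And>x y. 0 \<le> k x y"
    and C: "(\<integral>\<^sup>+ z. ennreal (k (fst z) (snd z)) \<partial>\<gamma>) = ennreal C" "0 \<le> C"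
    and s: "\<And>i w. i \<in> {1..N} \<Longrightarrow> w \<in> W \<Longrightarrow> g w \<le> s (what i) + \<eta> * k w (what i)"
  shows "(\<integral>w. g w \<partial>\<mu>) \<le> (\<Sum>i=1..N. s (what i)) / real N + \<eta> * C"
proof -
  from \<gamma> have sets_\<gamma>[measurable_cong]: "sets \<gamma> = sets (borel_on W \<Otimes>\<^sub>M borel_on W)"
    and "prob_space \<gamma>" and fst: "distr \<gamma> (borel_on W) fst = \<mu>"
    and snd: "distr \<gamma> (borel_on W) snd = empirical W N what"
    by (auto simp: couplings_def)
  interpret prob_space \<gamma> by fact
  have space_\<gamma>: "space \<gamma> = W \<times> W"
    using sets_eq_imp_space_eq[OF sets_\<gamma>] by (simp add: space_pair_measure space_restrict_space)
  define F where "F = what ` {1..N}"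
  \<comment> \<open>Nothing is known about measurability of \<open>s\<close>, which will be a
    supremum over \<open>W\<close>. It is replaced by a bounded measurable function that agrees with
    it on the samples. The sum runs over the set \<open>F\<close>, so that a repeated sample enters
    only once.\<close>
  define s' where "s' y = (\<Sum>z\<in>F. s z * indicat_real {z} y)" for y
  have s'_eq: "s' y = s y" if "y \<in> F" for y
  proof -
    have "s' y = (\<Sum>z\<in>F. if z = y then s z else 0)"
      unfolding s'_def by (rule sum.cong) (auto simp: indicator_def)
    then show ?thesis using that by (simp add: F_def)
  qed
  have sing: "{z} \<in> sets (borel_on W)" if "z \<in> F" for z
    using that what by (auto simp: F_def sets_restrict_space image_iff intro!: bexI[of _ "{z}"])
  have s'[measurable]: "s' \<in> borel_measurable (borel_on W)"
    unfolding s'_def using sing by (intro borel_measurable_sum borel_measurable_times) auto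
  have fm[measurable]: "fst \<in> \<gamma> \<rightarrow>\<^sub>M borel_on W" and sm[measurable]: "snd \<in> \<gamma> \<rightarrow>\<^sub>M borel_on W"
    by measurable
  have gm: "g \<in> borel_measurable (borel_on W)"
    using g by (auto simp: fst[symmetric])
  have gi: "integrable \<gamma> (\<lambda>z. g (fst z))"
    using g integrable_distr_eq[OF fm gm] by (simp add: fst)
  have ki: "integrable \<gamma> (\<lambda>z. k (fst z) (snd z))" "(\<integral>z. k (fst z) (snd z) \<partial>\<gamma>) = C"
    using nn_integral_eq_integrable[of "\<lambda>z. k (fst z) (snd z)" \<gamma> C] C k k0
    by (auto simp: measurable_cong_sets[OF sets_\<gamma> refl])
  have s'i: "integrable \<gamma> (\<lambda>z. s' (snd z))"
  proof (rule integrable_const_bound)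
    show "AE z in \<gamma>. norm (s' (snd z)) \<le> (\<Sum>z\<in>F. \<bar>s z\<bar>)"
      unfolding s'_def
      by (auto intro!: AE_I2 order.trans[OF sum_abs] sum_mono simp: indicator_def)
  qed measurable
  have "AE y in distr \<gamma> (borel_on W) snd. y \<in> F"
    unfolding snd F_def by (rule AE_empirical[OF what])
  then have aeF: "AE z in \<gamma>. snd z \<in> F"
    by (rule AE_distrD[OF sm])
  have "(\<integral>w. g w \<partial>\<mu>) = (\<integral>z. g (fst z) \<partial>\<gamma>)"
    using integral_distr[OF fm gm] by (simp add: fst)
  also have "\<dots> \<le> (\<integral>z. s' (snd z) + \<eta> * k (fst z) (snd z) \<partial>\<gamma>)"
  proof (rule integral_mono_AE)
    show "AE z in \<gamma>. g (fst z) \<le> s' (snd z) + \<eta> * k (fst z) (snd z)"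
      using aeF AE_space
      by eventually_elim (auto simp: space_\<gamma> s'_eq, auto simp: F_def intro: s)
  qed (use gi ki s'i in auto)
  also have "\<dots> = (\<integral>y. s' y \<partial>empirical W N what) + \<eta> * C"
    using ki s'i integral_distr[OF sm s'] by (simp add: snd)
  also have "(\<integral>y. s' y \<partial>empirical W N what) = (\<Sum>i=1..N. s (what i)) / real N"
    using integral_empirical[OF what s'] by (simp add: s'_eq F_def)
  finally show ?thesis .
qed

text \<open>On nonnegative reals the powers \<open>p\<close> and \<open>1 / p\<close> are monotone
  and inverse to each other; for infinite cost both sides fail. This allows working with the
  transport cost instead of its root.\<close>

lemma wasserstein_le_iff:
  assumes "0 < p" "0 \<le> \<theta>"
  shows "wasserstein W d p \<mu> \<nu> \<le> ennreal \<theta> \<longleftrightarrow>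
    (INF \<gamma>\<in>couplings W \<mu> \<nu>. \<integral>\<^sup>+ z. ennreal (d (fst z) (snd z) powr p) \<partial>\<gamma>) \<le> ennreal (\<theta> powr p)"
    (is "_ \<longleftrightarrow> ?C \<le> _")
proof (cases ?C)
  case (real C)
  have "C powr (1 / p) \<le> \<theta> \<longleftrightarrow> C \<le> \<theta> powr p"
  proof
    assume "C powr (1 / p) \<le> \<theta>"
    then have "(C powr (1 / p)) powr p \<le> \<theta> powr p" using assms by (intro powr_mono2) auto
    then show "C \<le> \<theta> powr p" using real assms by (simp add: powr_powr)
  next
    assume "C \<le> \<theta> powr p"
    then have "C powr (1 / p) \<le> (\<theta> powr p) powr (1 / p)" using real assms by (intro powr_mono2) auto
    then show "C powr (1 / p) \<le> \<theta>" using real assms by (simp add: powr_powr)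
  qed
  then show ?thesis
    using real assms by (simp add: wasserstein_def Let_def)
next
  case top
  then show ?thesis by (simp add: wasserstein_def Let_def top_unique)
qed

lemma wasserstein_ball_integral_le:
  fixes what :: "nat \<Rightarrow> 'a::t1_space"
  assumes \<mu>: "\<mu> \<in> wasserstein_ball W d p \<theta> N what"
    and p: "0 < p" and \<theta>: "0 \<le> \<theta>"
    and what: "what \<in> {1..N} \<rightarrow> W"
    and g: "integrable \<mu> g"
    and d: "(\<lambda>z. d (fst z) (snd z)) \<in> borel_measurable (borel_on W \<Otimes>\<^sub>M borel_on W)"
    and \<eta>: "0 \<le> \<eta>"
    and s: "\<And>i w. i \<in> {1..N} \<Longrightarrow> w \<in> W \<Longrightarrow> g w \<le> s (what i) + \<eta> * d w (what i) powr p"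
  shows "(\<integral>w. g w \<partial>\<mu>) \<le> (\<Sum>i=1..N. s (what i)) / real N + \<eta> * \<theta> powr p"
proof (rule field_le_epsilon)
  fix e :: real assume e: "0 < e"
  \<comment> \<open>Dividing by \<open>\<eta> + 1\<close> instead of \<eta> gives
    \<open>\<eta> * \<delta> \<le> e\<close> also when \<eta> is 0.\<close>
  define \<delta> where "\<delta> = e / (\<eta> + 1)"
  have \<delta>: "0 < \<delta>" using e \<eta> by (simp add: \<delta>_def)
  let ?cost = "\<lambda>\<gamma>. \<integral>\<^sup>+ z. ennreal (d (fst z) (snd z) powr p) \<partial>\<gamma>"
  have "(INF \<gamma>\<in>couplings W \<mu> (empirical W N what). ?cost \<gamma>) \<le> ennreal (\<theta> powr p)"
    using \<mu> p \<theta> by (simp add: wasserstein_ball_def wasserstein_le_iff)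
  also have "\<dots> < ennreal (\<theta> powr p + \<delta>)"
    using \<delta> by (intro ennreal_lessI) (auto intro: add_nonneg_pos)
  finally obtain \<gamma> where \<gamma>: "\<gamma> \<in> couplings W \<mu> (empirical W N what)"
    and less: "?cost \<gamma> < ennreal (\<theta> powr p + \<delta>)"
    by (auto simp: INF_less_iff)
  from less obtain C where C: "?cost \<gamma> = ennreal C" "0 \<le> C"
    by (cases "?cost \<gamma>") auto
  with less have C_le: "C \<le> \<theta> powr p + \<delta>"
    by (simp add: ennreal_less_iff)
  have "(\<integral>w. g w \<partial>\<mu>) \<le> (\<Sum>i=1..N. s (what i)) / real N + \<eta> * C"
    by (rule coupling_integral_le[where k = "\<lambda>x y. d x y powr p", OF \<gamma> what g _ _ C s])
      (use d in measurable)
  also have "\<eta> * C \<le> \<eta> * (\<theta> powr p + \<delta>)"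
    using C_le \<eta> by (rule mult_left_mono)
  also have "\<eta> * \<delta> \<le> e"
    using e \<eta> by (simp add: \<delta>_def field_simps)
  then have "\<eta> * (\<theta> powr p + \<delta>) \<le> \<eta> * \<theta> powr p + e"
    by (simp add: distrib_left)
  finally show "(\<integral>w. g w \<partial>\<mu>) \<le> (\<Sum>i=1..N. s (what i)) / real N + \<eta> * \<theta> powr p + e"
    by simp
qed

section \<open>Two-point mixtures as members of the ball\<close>

text \<open>The measure is the law of a random point: draw an index uniformly, toss an independent
  coin with success probability \<open>q1\<close>, and take \<open>wl i\<close> or
  \<open>wu i\<close> accordingly. Pairing this point with \<open>what i\<close> gives a coupling
  whose cost is the left-hand side of the constraint in \<open>two_point_set\<close>.\<close>

lemma two_point_measure:
  fixes d :: "'a::topological_space \<Rightarrow> 'a \<Rightarrow> real"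
  assumes N: "1 \<le> N" and what: "what \<in> {1..N} \<rightarrow> W"
    and p: "0 < p" and \<theta>: "0 \<le> \<theta>"
    and d: "(\<lambda>z. d (fst z) (snd z)) \<in> borel_measurable (borel_on W \<Otimes>\<^sub>M borel_on W)"
    and B: "((wl, wu), (q1, q2)) \<in> two_point_set W d p \<theta> N what"
  obtains \<mu> where "\<mu> \<in> wasserstein_ball W d p \<theta> N what"
    and "\<And>h :: 'a \<Rightarrow> real. h \<in> borel_measurable (borel_on W) \<Longrightarrow>
      (\<integral>w. h w \<partial>\<mu>) = (\<Sum>i=1..N. q1 * h (wl i) + q2 * h (wu i)) / real N"
proof -
  from B have wl: "wl \<in> {1..N} \<rightarrow> W" and wu: "wu \<in> {1..N} \<rightarrow> W"
    and q: "0 \<le> q1" "q1 \<le> 1" "q2 = 1 - q1"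
    and cost: "(\<Sum>i=1..N. q1 * d (wl i) (what i) powr p + q2 * d (wu i) (what i) powr p) / real N
      \<le> \<theta> powr p"
    by (auto simp: two_point_set_def simplex2_def PiE_iff)
  define A where "A = uniform_count_measure {1..N}"
  define Q where "Q = measure_pmf (bernoulli_pmf q1)"
  interpret A: prob_space A
    unfolding A_def using N by (intro prob_space_uniform_count_measure) auto
  interpret Q: prob_space Q
    unfolding Q_def by (rule measure_pmf.prob_space_axioms)
  interpret AQ: pair_prob_space A Q ..
  have sA: "space A = {1..N}" by (simp add: A_def space_uniform_count_measure)
  have sQ[measurable_cong]: "sets Q = sets (count_space UNIV)" by (simp add: Q_def)
  have [measurable]: "what \<in> A \<rightarrow>\<^sub>M borel_on W" "wl \<in> A \<rightarrow>\<^sub>M borel_on W" "wu \<in> A \<rightarrow>\<^sub>M borel_on W"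
    unfolding A_def by (intro measurable_empirical_sample what wl wu)+
  define k where "k = (\<lambda>(i, b). (if b then wl i else wu i, what i))"
  have k[measurable]: "k \<in> A \<Otimes>\<^sub>M Q \<rightarrow>\<^sub>M borel_on W \<Otimes>\<^sub>M borel_on W"
    unfolding k_def case_prod_beta by measurable
  define \<gamma> where "\<gamma> = distr (A \<Otimes>\<^sub>M Q) (borel_on W \<Otimes>\<^sub>M borel_on W) k"
  \<comment> \<open>The product has only \<open>2 * N\<close> points, so the sum of all absolute
    values of \<open>h\<close> bounds it, and integrability comes for free.\<close>
  have AQ_int: "integrable (A \<Otimes>\<^sub>M Q) h"
    "(\<integral>z. h z \<partial>(A \<Otimes>\<^sub>M Q)) = (\<Sum>i=1..N. q1 * h (i, True) + q2 * h (i, False)) / real N"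
    if h: "h \<in> borel_measurable (A \<Otimes>\<^sub>M Q)" for h :: "_ \<Rightarrow> real"
  proof -
    have "\<bar>h (i, b)\<bar> \<le> (\<Sum>z\<in>{1..N} \<times> UNIV. \<bar>h z\<bar>)" if "i \<in> {1..N}" for i b
      using that by (intro member_le_sum) auto
    then show i: "integrable (A \<Otimes>\<^sub>M Q) h"
      by (intro AQ.P.integrable_const_bound[where B = "\<Sum>z\<in>{1..N} \<times> UNIV. \<bar>h z\<bar>"] AE_I2 h)
        (auto simp: space_pair_measure sA)
    have "(\<integral>z. h z \<partial>(A \<Otimes>\<^sub>M Q)) = (\<integral>i. (\<integral>b. h (i, b) \<partial>Q) \<partial>A)"
      using AQ.integral_fst'[OF i] by simp
    then show "(\<integral>z. h z \<partial>(A \<Otimes>\<^sub>M Q)) = (\<Sum>i=1..N. q1 * h (i, True) + q2 * h (i, False)) / real N"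
      using q by (simp add: Q_def A_def integral_uniform_count_measure mult.commute)
  qed
  let ?\<mu> = "distr \<gamma> (borel_on W) fst"
  have "prob_space \<gamma>"
    unfolding \<gamma>_def by (rule AQ.P.prob_space_distr[OF k])
  then have "prob_space ?\<mu>"
    by (rule prob_space.prob_space_distr) (simp add: \<gamma>_def)
  \<comment> \<open>The second component ignores the coin, so its law is the image under
    \<open>what\<close> of the index marginal.\<close>
  have "distr \<gamma> (borel_on W) snd = distr (A \<Otimes>\<^sub>M Q) (borel_on W) (\<lambda>z. what (fst z))"
    unfolding \<gamma>_def by (subst distr_distr) (auto simp: k_def comp_def case_prod_beta)
  also have "\<dots> = distr (distr (A \<Otimes>\<^sub>M Q) A fst) (borel_on W) what"
    by (subst distr_distr) (auto simp: comp_def)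
  also have "\<dots> = empirical W N what"
    by (simp add: Q.distr_pair_fst empirical_def A_def)
  finally have \<gamma>: "\<gamma> \<in> couplings W ?\<mu> (empirical W N what)"
    using \<open>prob_space \<gamma>\<close> by (simp add: couplings_def) (simp add: \<gamma>_def)
  have dk[measurable]: "(\<lambda>z. d (fst (k z)) (snd (k z)) powr p) \<in> borel_measurable (A \<Otimes>\<^sub>M Q)"
    using measurable_compose[OF k d] by measurable
  have "(\<integral>\<^sup>+ z. ennreal (d (fst z) (snd z) powr p) \<partial>\<gamma>)
      = (\<integral>\<^sup>+ z. ennreal (d (fst (k z)) (snd (k z)) powr p) \<partial>(A \<Otimes>\<^sub>M Q))"
    unfolding \<gamma>_def using d by (subst nn_integral_distr) auto
  also have "\<dots> = ennreal (\<integral>z. d (fst (k z)) (snd (k z)) powr p \<partial>(A \<Otimes>\<^sub>M Q))"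
    by (rule nn_integral_eq_integral[OF AQ_int(1)[OF dk]]) simp
  also have "\<dots> \<le> ennreal (\<theta> powr p)"
    unfolding AQ_int(2)[OF dk] using cost by (intro ennreal_leI) (simp add: k_def)
  finally have "(INF \<gamma>\<in>couplings W ?\<mu> (empirical W N what).
      \<integral>\<^sup>+ z. ennreal (d (fst z) (snd z) powr p) \<partial>\<gamma>) \<le> ennreal (\<theta> powr p)"
    by (rule INF_lower2[OF \<gamma>])
  then have ball: "?\<mu> \<in> wasserstein_ball W d p \<theta> N what"
    using \<open>prob_space ?\<mu>\<close> p \<theta>
    by (simp add: wasserstein_ball_def prob_measures_def wasserstein_le_iff)
  show thesis
  proof (rule that[OF ball])
    fix h :: "'a \<Rightarrow> real" assume h[measurable]: "h \<in> borel_measurable (borel_on W)"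
    have "(\<integral>w. h w \<partial>?\<mu>) = (\<integral>z. h (fst (k z)) \<partial>(A \<Otimes>\<^sub>M Q))"
      unfolding \<gamma>_def by (simp add: distr_distr integral_distr comp_def)
    also have "\<dots> = (\<Sum>i=1..N. q1 * h (wl i) + q2 * h (wu i)) / real N"
      by (subst AQ_int(2)) (auto simp: k_def)
    finally show "(\<integral>w. h w \<partial>?\<mu>) = (\<Sum>i=1..N. q1 * h (wl i) + q2 * h (wu i)) / real N" .
  qed
qed

text \<open>Leaving every sample in place costs nothing. This makes the supremum over the two-point
  set one over a nonempty set and, through \<open>two_point_measure\<close>, supplies a member of
  the ball.\<close>

lemma center_in_two_point_set:
  assumes what: "what \<in> {1..N} \<rightarrow> W" and "\<And>w. w \<in> W \<Longrightarrow> d w w = 0"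
  shows "((restrict what {1..N}, restrict what {1..N}), (1, 0)) \<in> two_point_set W d p \<theta> N what"
  using assms by (simp add: two_point_set_def simplex2_def Pi_mem[OF what])

section \<open>Two-point mixtures dominate the whole ball\<close>

text \<open>Separation is applied to whole tuples in the product rather than to single samples,
  which is why one pair of weights shared by all samples suffices. The slope \<eta> is the Lagrange
  multiplier of the transport budget and serves all samples alike.\<close>

lemma wasserstein_ball_integral_le_two_point:
  fixes what :: "nat \<Rightarrow> 'a::t1_space"
  assumes N: "1 \<le> N" and what: "what \<in> {1..N} \<rightarrow> W"
    and p: "0 < p" and \<theta>: "0 < \<theta>"
    and d: "(\<lambda>z. d (fst z) (snd z)) \<in> borel_measurable (borel_on W \<Otimes>\<^sub>M borel_on W)"
    and d0: "\<And>w. w \<in> W \<Longrightarrow> d w w = 0"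
    and V: "\<And>wl wu q1 q2. ((wl, wu), (q1, q2)) \<in> two_point_set W d p \<theta> N what \<Longrightarrow>
      (\<Sum>i=1..N. q1 * g (wl i) + q2 * g (wu i)) / real N \<le> V"
    and \<mu>: "\<mu> \<in> wasserstein_ball W d p \<theta> N what" and g: "integrable \<mu> g"
  shows "(\<integral>w. g w \<partial>\<mu>) \<le> V"
proof -
  let ?I = "{1..N} \<rightarrow>\<^sub>E W"
  define a where "a w = (\<Sum>i=1..N. d (w i) (what i) powr p) / real N" for w
  define b where "b w = (\<Sum>i=1..N. g (w i)) / real N" for w
  let ?T = "\<theta> powr p"
  \<comment> \<open>The Slater point: the samples have cost 0, strictly below the budget because
    \<theta> is positive.\<close>
  have center: "restrict what {1..N} \<in> ?I" "a (restrict what {1..N}) < ?T"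
    using what d0 \<theta> by (auto simp: a_def Pi_mem[OF what])
  have two: "q * b wl + (1 - q) * b wu \<le> V"
    if "wl \<in> ?I" "wu \<in> ?I" "0 \<le> q" "q \<le> 1" "q * a wl + (1 - q) * a wu \<le> ?T" for wl wu q
  proof -
    have "((wl, wu), (q, 1 - q)) \<in> two_point_set W d p \<theta> N what"
      using that by (simp add: two_point_set_def simplex2_def a_def sum.distrib add_divide_distrib
          sum_distrib_left)
    from V[OF this] show ?thesis
      by (simp add: b_def sum.distrib add_divide_distrib sum_distrib_left)
  qed
  obtain \<eta> where \<eta>: "0 \<le> \<eta>" "\<And>w. w \<in> ?I \<Longrightarrow> b w \<le> V + \<eta> * (a w - ?T)"
  proof -
    have "\<exists>\<eta>\<ge>0. \<forall>w\<in>?I. b w \<le> V + \<eta> * (a w - ?T)"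
      by (rule slope_separation[where a = a and b = b, OF center]) (rule two)
    then show thesis using that by blast
  qed
  \<comment> \<open>Written as \<open>b w - \<eta> * a w \<le> V - \<eta> * ?T\<close>, the line
    inequality is a bound on a sum with one term per sample, and \<phi> is that term.\<close>
  define \<phi> where "\<phi> y w = g w - \<eta> * d w y powr p" for y w
  define s where "s y = (SUP w\<in>W. \<phi> y w)" for y
  have sum_\<phi>: "(\<Sum>i\<in>{1..N}. \<phi> (what i) (w i)) \<le> real N * (V - \<eta> * ?T)" if "w \<in> ?I" for w
  proof -
    have "(\<Sum>i\<in>{1..N}. \<phi> (what i) (w i)) = real N * (b w - \<eta> * a w)"
      using N by (simp add: \<phi>_def a_def b_def sum_subtractf sum_distrib_left[symmetric] right_diff_distrib)
    also have "\<dots> \<le> real N * (V - \<eta> * ?T)"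
      using \<eta>(2)[OF that] by (intro mult_left_mono) (auto simp: algebra_simps)
    finally show ?thesis .
  qed
  have "W \<noteq> {}" using Pi_mem[OF what, of 1] N by auto
  \<comment> \<open>Besides bounding the sum of the suprema, this shows that each
    \<open>s (what i)\<close> is the supremum of a set bounded above, without which it would not
    dominate \<phi>.\<close>
  note sup = sum_SUP_le[of "{1..N}" W "\<lambda>i. \<phi> (what i)", OF _ this sum_\<phi>]
  have "(\<integral>w. g w \<partial>\<mu>) \<le> (\<Sum>i=1..N. s (what i)) / real N + \<eta> * ?T"
  proof (rule wasserstein_ball_integral_le[OF \<mu> p _ what g d \<eta>(1)])
    fix i w assume "i \<in> {1..N}" "w \<in> W"
    then have "\<phi> (what i) w \<le> s (what i)"
      unfolding s_def using sup(1) by (intro cSUP_upper) auto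
    then show "g w \<le> s (what i) + \<eta> * d w (what i) powr p" by (simp add: \<phi>_def)
  qed (use \<theta> in auto)
  \<comment> \<open>The budget term subtracted here cancels the one added by the coupling bound,
    leaving \<open>V\<close>.\<close>
  also have "(\<Sum>i=1..N. s (what i)) / real N \<le> V - \<eta> * ?T"
    using sup(2) N by (simp add: s_def pos_divide_le_eq mult.commute)
  finally show ?thesis by simp
qed

section \<open>The operator and its two-point form\<close>

theorem proposition3:
  fixes X :: "(real ^ 'n) set" and U :: "(real ^ 'm) set" and W :: "(real ^ 'l) set"
    and adm :: "real ^ 'n \<Rightarrow> (real ^ 'm) set"
    and f :: "real ^ 'n \<Rightarrow> real ^ 'm \<Rightarrow> real ^ 'l \<Rightarrow> real ^ 'n"
    and c :: "real ^ 'n \<Rightarrow> real ^ 'm \<Rightarrow> real"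
    and d :: "real ^ 'l \<Rightarrow> real ^ 'l \<Rightarrow> real"
    and what :: "nat \<Rightarrow> real ^ 'l"
    and \<xi> v :: "real ^ 'n \<Rightarrow> real" and \<pi> :: "real ^ 'n \<Rightarrow> real ^ 'm"
    and \<alpha> p \<theta> :: real and N :: nat and D :: "(real ^ 'l) measure set"
  assumes "X \<in> sets borel" and "U \<in> sets borel" and "W \<in> sets borel"
    and "\<And>x. x \<in> X \<Longrightarrow> adm x \<subseteq> U"
    and f_range: "\<And>x u w. x \<in> X \<Longrightarrow> u \<in> U \<Longrightarrow> w \<in> W \<Longrightarrow> f x u w \<in> X"
    and f_measurable:
      "\<And>x u. (x, u) \<in> graph_adm X U adm \<Longrightarrow> (\<lambda>w. f x u w) \<in> borel_on W \<rightarrow>\<^sub>M borel_on X"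
    and "0 < \<alpha>" and "\<alpha> < 1"
    and "1 \<le> N" and "\<And>i. i \<in> {1..N} \<Longrightarrow> what i \<in> W"
    and "1 \<le> p" and "0 < \<theta>"
    and "Metric_space W d"
    and d_measurable: "(\<lambda>z. d (fst z) (snd z)) \<in> borel_measurable (borel_on W \<Otimes>\<^sub>M borel_on W)"
    and D: "D = wasserstein_ball W d p \<theta> N what"
    and "assumption_A X U adm f c \<alpha> D \<xi>"
    and "\<pi> \<in> stationary_policies X U adm"
    and "v \<in> weighted_bounded X \<xi>"
  shows "finite_weighted_norm X \<xi> (dr_operator f c \<alpha> D \<pi> v) \<and>
    (\<forall>x\<in>X.
       bdd_above (dr_value f c \<alpha> \<pi> v x ` D) \<and>
       bdd_above (two_point_value f c \<alpha> N \<pi> v x ` two_point_set W d p \<theta> N what) \<and>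
       dr_operator f c \<alpha> D \<pi> v x
         = (SUP wq\<in>two_point_set W d p \<theta> N what. two_point_value f c \<alpha> N \<pi> v x wq))"
proof -
  have p: "0 < p" and \<theta>: "0 < \<theta>" "0 \<le> \<theta>" and \<alpha>: "0 < \<alpha>" and N: "1 \<le> N"
    and what: "what \<in> {1..N} \<rightarrow> W"
    using assms by auto
  have d0: "\<And>w. w \<in> W \<Longrightarrow> d w w = 0"
    using \<open>Metric_space W d\<close> by (simp add: Metric_space.mdist_zero)
  from \<open>v \<in> weighted_bounded X \<xi>\<close> have v: "v \<in> borel_measurable (borel_on X)"
    and "bdd_above ((\<lambda>x. \<bar>v x\<bar> / \<xi> x) ` X)"
    by (auto simp: weighted_bounded_def finite_weighted_norm_def)
  then obtain k where k: "\<And>x. x \<in> X \<Longrightarrow> \<bar>v x\<bar> / \<xi> x \<le> k" by (auto simp: bdd_above_def)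
  note A = \<open>assumption_A X U adm f c \<alpha> D \<xi>\<close>[unfolded assumption_A_def Let_def]
  from A have "\<forall>x\<in>X. 1 \<le> \<xi> x"
    and "\<exists>b\<ge>0. \<forall>(x, u)\<in>graph_adm X U adm. \<bar>c x u\<bar> \<le> b * \<xi> x"
    and "\<forall>\<mu>\<in>D. (\<forall>(x, u)\<in>graph_adm X U adm. integrable \<mu> (\<lambda>w. \<xi> (f x u w))) \<and>
      continuous_on (graph_adm X U adm) (\<lambda>(x, u). \<integral>w. \<xi> (f x u w) \<partial>\<mu>)"
    and "\<exists>\<beta>. 1 \<le> \<beta> \<and> \<beta> < 1 / \<alpha> \<and>
      (\<forall>\<mu>\<in>D. \<forall>(x, u)\<in>graph_adm X U adm. (\<integral>w. \<xi> (f x u w) \<partial>\<mu>) \<le> \<beta> * \<xi> x)"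
    by - (elim conjE, assumption)+
  then obtain b \<beta> where \<xi>: "\<And>x. x \<in> X \<Longrightarrow> 1 \<le> \<xi> x"
    and b: "\<And>x u. (x, u) \<in> graph_adm X U adm \<Longrightarrow> \<bar>c x u\<bar> \<le> b * \<xi> x"
    and \<xi>i: "\<And>\<mu> x u. \<mu> \<in> D \<Longrightarrow> (x, u) \<in> graph_adm X U adm \<Longrightarrow>
      integrable \<mu> (\<lambda>w. \<xi> (f x u w))"
    and \<beta>: "\<And>\<mu> x u. \<mu> \<in> D \<Longrightarrow> (x, u) \<in> graph_adm X U adm \<Longrightarrow>
      (\<integral>w. \<xi> (f x u w) \<partial>\<mu>) \<le> \<beta> * \<xi> x"
    by fastforce
  let ?B = "two_point_set W d p \<theta> N what"
  let ?center = "((restrict what {1..N}, restrict what {1..N}), (1::real, 0::real))"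
  \<comment> \<open>A bound on the weighted norm of the image that is uniform in \<open>x\<close>:
    \<open>b\<close> comes from the stage cost, \<open>k\<close> from the weighted bound on
    \<open>v\<close>, and \<beta> from the growth of \<xi> along the dynamics. The absolute value
    spares a discussion of the sign of \<open>k\<close>.\<close>
  define K where "K = b + \<alpha> * (\<bar>k\<bar> * \<beta>)"
  have center: "?center \<in> ?B"
    by (rule center_in_two_point_set) (use what d0 in auto)
  obtain \<mu>0 where \<mu>0: "\<mu>0 \<in> D"
    using two_point_measure[OF N what p \<theta>(2) d_measurable center] D by blast
  have pointwise: "(\<forall>\<mu>\<in>D. \<bar>dr_value f c \<alpha> \<pi> v x \<mu>\<bar> \<le> K * \<xi> x) \<and>
      bdd_above (two_point_value f c \<alpha> N \<pi> v x ` ?B) \<and>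
      dr_operator f c \<alpha> D \<pi> v x = (SUP wq\<in>?B. two_point_value f c \<alpha> N \<pi> v x wq)"
    if x: "x \<in> X" for x
  proof -
    have "\<pi> x \<in> adm x" using \<open>\<pi> \<in> stationary_policies X U adm\<close> x
      by (auto simp: stationary_policies_def)
    then have u: "\<pi> x \<in> U" and g: "(x, \<pi> x) \<in> graph_adm X U adm"
      using assms(4)[OF x] x by (auto simp: graph_adm_def)
    \<comment> \<open>For fixed \<open>x\<close> the claim concerns a single reward function on
      \<open>W\<close>; the stage cost and the factor \<alpha> form an increasing affine map applied
      to its integral.\<close>
    define h where "h w = v (f x (\<pi> x) w)" for w
    have hm[measurable]: "h \<in> borel_measurable (borel_on W)"
      unfolding h_def by (rule measurable_compose[OF f_measurable[OF g] v])
    have h_le: "\<bar>h w\<bar> \<le> \<bar>k\<bar> * \<xi> (f x (\<pi> x) w)" if "w \<in> W" for w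
    proof -
      have fx: "f x (\<pi> x) w \<in> X" by (rule f_range[OF x u that])
      have "\<bar>h w\<bar> \<le> k * \<xi> (f x (\<pi> x) w)"
        using k[OF fx] \<xi>[OF fx] by (simp add: h_def pos_divide_le_eq)
      also have "\<dots> \<le> \<bar>k\<bar> * \<xi> (f x (\<pi> x) w)"
        using \<xi>[OF fx] by (intro mult_right_mono) auto
      finally show ?thesis .
    qed
    \<comment> \<open>Domination by a multiple of \<xi> along the dynamics; since \<beta> does not
      depend on \<mu>, the bound is uniform over the ball and the real supremum is a genuine
      one.\<close>
    have hi: "integrable \<mu> h" and h_int: "\<bar>\<integral>w. h w \<partial>\<mu>\<bar> \<le> \<bar>k\<bar> * \<beta> * \<xi> x" if \<mu>: "\<mu> \<in> D" for \<mu>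
    proof -
      have sets: "sets \<mu> = sets (borel_on W)"
        using \<mu> by (simp add: D wasserstein_ball_def prob_measures_def)
      then have space: "space \<mu> = W"
        using sets_eq_imp_space_eq[OF sets] by (simp add: space_restrict_space)
      have \<xi>i': "integrable \<mu> (\<lambda>w. \<bar>k\<bar> * \<xi> (f x (\<pi> x) w))"
        using \<xi>i[OF \<mu> g] by simp
      have ae: "AE w in \<mu>. norm (h w) \<le> \<bar>k\<bar> * \<xi> (f x (\<pi> x) w)"
        using h_le by (intro AE_I2) (simp add: space)
      have "h \<in> borel_measurable \<mu>"
        using hm by (simp only: measurable_cong_sets[OF sets refl])
      then show "integrable \<mu> h"
        by (rule Bochner_Integration.integrable_bound[OF \<xi>i'])
          (use ae in \<open>eventually_elim, simp\<close>)
      have "\<bar>\<integral>w. h w \<partial>\<mu>\<bar> \<le> (\<integral>w. \<bar>k\<bar> * \<xi> (f x (\<pi> x) w) \<partial>\<mu>)"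
        using Bochner_Integration.integral_norm_bound_integral[OF \<open>integrable \<mu> h\<close> \<xi>i'] h_le by (simp add: space)
      also have "\<dots> \<le> \<bar>k\<bar> * (\<beta> * \<xi> x)"
        using \<beta>[OF \<mu> g] by (simp add: mult_left_mono)
      finally show "\<bar>\<integral>w. h w \<partial>\<mu>\<bar> \<le> \<bar>k\<bar> * \<beta> * \<xi> x" by simp
    qed
    have dr: "dr_value f c \<alpha> \<pi> v x \<mu> = c x (\<pi> x) + \<alpha> * (\<integral>w. h w \<partial>\<mu>)" for \<mu>
      by (simp add: dr_value_def h_def)
    have tp: "two_point_value f c \<alpha> N \<pi> v x ((wl, wu), (q1, q2))
        = c x (\<pi> x) + \<alpha> * ((\<Sum>i=1..N. q1 * h (wl i) + q2 * h (wu i)) / real N)" for wl wu q1 q2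
      by (simp add: two_point_value_def h_def)
    have bound: "\<bar>dr_value f c \<alpha> \<pi> v x \<mu>\<bar> \<le> K * \<xi> x" if "\<mu> \<in> D" for \<mu>
    proof -
      have "\<bar>dr_value f c \<alpha> \<pi> v x \<mu>\<bar> \<le> \<bar>c x (\<pi> x)\<bar> + \<alpha> * \<bar>\<integral>w. h w \<partial>\<mu>\<bar>"
        unfolding dr using \<alpha> by (simp add: abs_mult order.trans[OF abs_triangle_ineq])
      also have "\<dots> \<le> b * \<xi> x + \<alpha> * (\<bar>k\<bar> * \<beta> * \<xi> x)"
        using b[OF g] h_int[OF that] \<alpha> by (intro add_mono mult_left_mono) auto
      finally show ?thesis by (simp add: K_def algebra_simps)
    qed
    have bdd_D: "bdd_above (dr_value f c \<alpha> \<pi> v x ` D)"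
      using bound by (intro bdd_aboveI2[where M = "K * \<xi> x"]) (auto dest: abs_le_D1)
    \<comment> \<open>Each two-point value is attained exactly by a measure in the ball, which gives
      both boundedness of these values and one of the two inequalities.\<close>
    have sub: "two_point_value f c \<alpha> N \<pi> v x ` ?B \<subseteq> dr_value f c \<alpha> \<pi> v x ` D"
    proof (rule image_subsetI)
      fix z assume z: "z \<in> ?B"
      obtain wl wu q1 q2 where z_eq: "z = ((wl, wu), (q1, q2))" by (metis prod.exhaust)
      obtain \<mu> where "\<mu> \<in> D"
        and "(\<integral>w. h w \<partial>\<mu>) = (\<Sum>i=1..N. q1 * h (wl i) + q2 * h (wu i)) / real N"
        using two_point_measure[OF N what p \<theta>(2) d_measurable z[unfolded z_eq]] D hm by metis
      then show "two_point_value f c \<alpha> N \<pi> v x z \<in> dr_value f c \<alpha> \<pi> v x ` D"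
        unfolding z_eq tp by (intro image_eqI[of _ _ \<mu>]) (simp_all add: dr)
    qed
    have bdd_B: "bdd_above (two_point_value f c \<alpha> N \<pi> v x ` ?B)"
      by (rule bdd_above_mono[OF bdd_D sub])
    define S where "S = (SUP wq\<in>?B. two_point_value f c \<alpha> N \<pi> v x wq)"
    have "dr_operator f c \<alpha> D \<pi> v x = S"
      unfolding dr_operator_def
    proof (rule antisym)
      show "S \<le> (SUP \<mu>\<in>D. dr_value f c \<alpha> \<pi> v x \<mu>)"
        unfolding S_def using center by (intro cSup_subset_mono[OF _ bdd_D sub]) auto
      show "(SUP \<mu>\<in>D. dr_value f c \<alpha> \<pi> v x \<mu>) \<le> S"
      proof (rule cSUP_least)
        show "D \<noteq> {}" using \<mu>0 by auto
        fix \<mu> assume \<mu>: "\<mu> \<in> D"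
        \<comment> \<open>The threshold is the integral at which the affine map takes the value
          \<open>S\<close>.\<close>
        have "(\<integral>w. h w \<partial>\<mu>) \<le> (S - c x (\<pi> x)) / \<alpha>"
        proof (rule wasserstein_ball_integral_le_two_point[OF N what p \<theta>(1) d_measurable d0])
          fix wl wu q1 q2 assume "((wl, wu), (q1, q2)) \<in> ?B"
          then have "two_point_value f c \<alpha> N \<pi> v x ((wl, wu), (q1, q2)) \<le> S"
            unfolding S_def by (rule cSUP_upper[OF _ bdd_B])
          then show "(\<Sum>i=1..N. q1 * h (wl i) + q2 * h (wu i)) / real N \<le> (S - c x (\<pi> x)) / \<alpha>"
            unfolding tp pos_le_divide_eq[OF \<alpha>] by (simp add: mult.commute)
        qed (use \<mu> hi D in auto)
        then show "dr_value f c \<alpha> \<pi> v x \<mu> \<le> S"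
          unfolding dr pos_le_divide_eq[OF \<alpha>] by (simp add: mult.commute)
      qed
    qed
    with bound bdd_B show ?thesis by (simp add: S_def)
  qed
  have "finite_weighted_norm X \<xi> (dr_operator f c \<alpha> D \<pi> v)"
    unfolding finite_weighted_norm_def
  proof (rule bdd_aboveI2)
    fix x assume x: "x \<in> X"
    have "\<bar>dr_operator f c \<alpha> D \<pi> v x\<bar> \<le> K * \<xi> x"
      unfolding dr_operator_def
      by (rule cSup_abs_le) (use \<mu>0 pointwise[OF x] in auto)
    then show "\<bar>dr_operator f c \<alpha> D \<pi> v x\<bar> / \<xi> x \<le> K"
      using \<xi>[OF x] by (simp add: pos_divide_le_eq)
  qed
  moreover have "bdd_above (dr_value f c \<alpha> \<pi> v x ` D)" if "x \<in> X" for x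
    using pointwise[OF that] by (intro bdd_aboveI2[where M = "K * \<xi> x"]) (auto dest: abs_le_D1)
  ultimately show ?thesis
    using pointwise by (intro conjI ballI) simp_all
qed

end
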